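(* For each integer $t\ge 2$, every $F_{t,t}$-free bipartite graph $G=(B,W,E)$ has symmetric difference at most $2t$.
   Context: All graphs are finite and simple. $G$ is $H$-free if it has no induced subgraph isomorphic to $H$. The graph $F_{t,p}$ has vertices $u,v$ (the centres), $x_1,\dots,x_t$, $y_1,\dots,y_p$, $w$, $z$; its edges are $ux_i$ ($1\le i\le t$), $vy_j$ ($1\le j\le p$), $uw$ and $vw$; the vertex $z$ is isolated. For two distinct vertices $x,y$ of a graph $G$, $\mathrm{sd}(x,y)$ is the number of vertices in $V(G)\setminus\{x,y\}$ adjacent to exactly one of $x$ and $y$. The symmetric difference $\mathrm{sd}(G)$ of $G$ is the smallest number such that every induced subgraph $H$ of $G$ (with at least two vertices) contains a pair of distinct vertices whose symmetric difference, computed in $H$, is at most $\mathrm{sd}(G)$. *)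

theory Defs
  imports "Graph_Theory.Graph_Theory"
begin

text \<open>
  A finite simple undirected graph is a symmetric digraph satisfying the locale predicate
  \<^const>\<open>graph\<close>: finite, loop-free, without parallel arcs, each edge being a pair of
  opposite arcs. Adjacency of \<open>x\<close> and \<open>y\<close> in \<open>G\<close> is \<open>x \<rightarrow>\<^bsub>G\<^esub> y\<close>.
\<close>

definition induced_free :: "('c, 'd) pre_digraph \<Rightarrow> ('a, 'b) pre_digraph \<Rightarrow> bool" where
  "induced_free F G \<longleftrightarrow> \<not> (\<exists>H. induced_subgraph H G \<and> digraph_iso H F)"

definition bipartition :: "('a, 'b) pre_digraph \<Rightarrow> 'a set \<Rightarrow> 'a set \<Rightarrow> bool" where
  "bipartition G B W \<longleftrightarrow>
     B \<union> W = verts G \<and> B \<inter> W = {} \<and> arcs_ends G \<subseteq> B \<times> W \<union> W \<times> B"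

datatype F_vertex = U_centre | V_centre | X_leaf nat | Y_leaf nat | W_middle | Z_isolated

definition F_edges :: "nat \<Rightarrow> nat \<Rightarrow> F_vertex rel" where
  "F_edges t p =
     {(U_centre, X_leaf i) | i. i \<in> {1..t}} \<union> {(V_centre, Y_leaf j) | j. j \<in> {1..p}} \<union>
     {(U_centre, W_middle), (V_centre, W_middle)}"

definition F_graph :: "nat \<Rightarrow> nat \<Rightarrow> F_vertex pair_pre_digraph" where
  "F_graph t p =
     \<lparr> pverts = {U_centre, V_centre} \<union> X_leaf ` {1..t} \<union> Y_leaf ` {1..p} \<union> {W_middle, Z_isolated},
       parcs = F_edges t p \<union> (F_edges t p)\<inverse> \<rparr>"

definition sd_pair :: "('a, 'b) pre_digraph \<Rightarrow> 'a \<Rightarrow> 'a \<Rightarrow> nat" where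
  "sd_pair G x y = card {z \<in> verts G - {x, y}. (x \<rightarrow>\<^bsub>G\<^esub> z) \<noteq> (y \<rightarrow>\<^bsub>G\<^esub> z)}"

definition sd_bounded_by :: "('a, 'b) pre_digraph \<Rightarrow> nat \<Rightarrow> bool" where
  "sd_bounded_by G k \<longleftrightarrow>
     (\<forall>H. induced_subgraph H G \<and> card (verts H) \<ge> 2 \<longrightarrow>
        (\<exists>x \<in> verts H. \<exists>y \<in> verts H. x \<noteq> y \<and> sd_pair H x y \<le> k))"

definition symmetric_difference :: "('a, 'b) pre_digraph \<Rightarrow> nat" where
  "symmetric_difference G = (LEAST k. sd_bounded_by G k)"

lemma F_edges_distinct: "(a, b) \<in> F_edges t p \<Longrightarrow> a \<noteq> b"
  unfolding F_edges_def by auto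

lemma F_edges_verts:
  "(a, b) \<in> F_edges t p \<Longrightarrow> a \<in> pverts (F_graph t p) \<and> b \<in> pverts (F_graph t p)"
  unfolding F_edges_def F_graph_def by auto

lemma F_graph_arcs: "parcs (F_graph t p) = F_edges t p \<union> (F_edges t p)\<inverse>"
  by (simp add: F_graph_def)

lemma graph_F_graph: "graph (with_proj (F_graph t p))"
proof -
  have fin: "finite (pverts (F_graph t p))"
    by (simp add: F_graph_def)
  have sub: "parcs (F_graph t p) \<subseteq> pverts (F_graph t p) \<times> pverts (F_graph t p)"
    using F_edges_verts by (auto simp: F_graph_arcs)
  have "pair_graph (F_graph t p)"
  proof
    show "finite (parcs (F_graph t p))"
      by (rule finite_subset[OF sub finite_cartesian_product[OF fin fin]])
    show "symmetric (with_proj (F_graph t p))"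
      unfolding symmetric_def by (simp add: F_graph_arcs sym_Un_converse)
    show "fst e \<noteq> snd e" if "e \<in> parcs (F_graph t p)" for e
      using that F_edges_distinct by (cases e) (auto simp: F_graph_arcs)
    show "fst e \<in> pverts (F_graph t p)" "snd e \<in> pverts (F_graph t p)"
      if "e \<in> parcs (F_graph t p)" for e
      using subsetD[OF sub that] by (simp_all add: mem_Times_iff)
  qed (fact fin)
  then show ?thesis by (rule pair_graph.pair_graphD_graph)
qed

text \<open>On finite graphs the minimum defining \<^const>\<open>symmetric_difference\<close> exists.\<close>

lemma sd_bounded_by_symmetric_difference:
  assumes "graph G"
  shows "sd_bounded_by G (symmetric_difference G)"
proof -
  interpret graph G by fact
  have "sd_bounded_by G (card (verts G))"
    unfolding sd_bounded_by_def
  proof (intro allI impI)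
    fix H assume H: "induced_subgraph H G \<and> card (verts H) \<ge> 2"
    then have sub: "verts H \<subseteq> verts G"
      by (auto simp: induced_subgraph_def subgraph_def)
    obtain x y where xy: "x \<in> verts H" "y \<in> verts H" "x \<noteq> y"
      using H card_le_Suc0_iff_eq[OF finite_subset[OF sub finite_verts]] by force
    have "sd_pair H x y \<le> card (verts G)"
      unfolding sd_pair_def by (rule card_mono) (use sub in auto)
    with xy show "\<exists>x \<in> verts H. \<exists>y \<in> verts H. x \<noteq> y \<and> sd_pair H x y \<le> card (verts G)"
      by blast
  qed
  then show ?thesis
    unfolding symmetric_difference_def by (rule LeastI)
qed

end

theory Submission
  imports Defs
begin

text \<open>
  Suppose all symmetric differences in a bipartite induced subgraph with sides \<open>B\<close>, \<open>W\<close> exceed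
  \<open>2 * t\<close>. Two vertices on the same side whose degrees differ by at most 2 then have at least \<open>t\<close>
  private neighbours each, so, taking the isolated vertex of the forbidden graph on the opposite
  side, their neighbourhoods are disjoint or cover that side. Equivalently, if the neighbourhoods
  meet and do not cover, the degrees differ by at least 3. For \<open>p\<close>, \<open>q\<close> in \<open>W\<close> the low-degree
  neighbours of \<open>p\<close> and the high-degree non-neighbours of \<open>q\<close> have such spaced degrees, hence there
  are few of both, and all degrees in \<open>W\<close> lie in an interval of length about \<open>card W / 3\<close>. By the
  pigeonhole principle three vertices of \<open>W\<close> have pairwise close degrees; after complementing the
  adjacency relation if necessary, their neighbourhoods are pairwise disjoint. Then no two vertices
  of close degree in \<open>B\<close> have neighbourhoods covering \<open>W\<close>, and by applying the same to \<open>B\<close>, vertices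
  of close degree on either side have disjoint neighbourhoods. So the neighbours of a vertex of
  maximum degree have spaced degrees, which is impossible.
\<close>

section \<open>Neighbourhoods and degrees between two sides\<close>

definition nbr :: "('a \<Rightarrow> 'a \<Rightarrow> bool) \<Rightarrow> 'a set \<Rightarrow> 'a \<Rightarrow> 'a set" where
  "nbr E S x = {y \<in> S. E x y}"

text \<open>The slack 2 is what the bound \<open>2 * t\<close> permits: two private neighbourhoods
  whose sizes sum to at least \<open>2 * t + 1\<close> and differ by at most 2 both have size at
  least \<open>t\<close>.\<close>

definition close_deg :: "('a \<Rightarrow> 'a \<Rightarrow> bool) \<Rightarrow> 'a set \<Rightarrow> 'a \<Rightarrow> 'a \<Rightarrow> bool" where
  "close_deg E S x y \<longleftrightarrow>
     card (nbr E S x) \<le> card (nbr E S y) + 2 \<and> card (nbr E S y) \<le> card (nbr E S x) + 2"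

text \<open>This is all that is kept of the forbidden graph; of \<open>t\<close> only the bound 2
  survives. Since ordered pairs are quantified, it bounds both private neighbourhoods. An arbitrary
  relation \<open>E\<close> in place of a graph allows complementation.\<close>

definition cross_free :: "('a \<Rightarrow> 'a \<Rightarrow> bool) \<Rightarrow> 'a set \<Rightarrow> 'a set \<Rightarrow> bool" where
  "cross_free E B W \<longleftrightarrow>
     (\<forall>x \<in> B. \<forall>y \<in> B. x \<noteq> y \<longrightarrow> close_deg E W x y \<longrightarrow>
        card (nbr E W x - nbr E W y) \<ge> 2 \<and>
        (nbr E W x \<inter> nbr E W y = {} \<or> nbr E W x \<union> nbr E W y = W))"

lemma close_deg_commute: "close_deg E S x y \<longleftrightarrow> close_deg E S y x"
  by (auto simp: close_deg_def)

lemma mem_nbr_commute: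
  assumes "symp E" "x \<in> A" "y \<in> S"
  shows "y \<in> nbr E S x \<longleftrightarrow> x \<in> nbr E A y"
  using assms by (auto simp: nbr_def dest: sympD)

lemma finite_nbr [simp]: "finite S \<Longrightarrow> finite (nbr E S x)"
  by (simp add: nbr_def)

lemma nbr_subset: "nbr E S x \<subseteq> S"
  by (auto simp: nbr_def)

section \<open>Spaced degrees and vertices of close degree\<close>

text \<open>After shifting by \<open>l\<close>, division by 3 is injective on values at least 3
  apart, and its results lie below \<open>n / 3\<close> rounded up, which is
  \<open>(n + 2) div 3\<close>.\<close>

lemma card_spaced_le:
  fixes f :: "'b \<Rightarrow> nat"
  assumes "\<And>x. x \<in> S \<Longrightarrow> l \<le> f x \<and> f x < l + n"
    and "\<And>x y. x \<in> S \<Longrightarrow> y \<in> S \<Longrightarrow> x \<noteq> y \<Longrightarrow> f x + 2 < f y \<or> f y + 2 < f x"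
  shows "3 * card S \<le> n + 2"
proof -
  let ?g = "\<lambda>x. (f x - l) div 3"
  have "inj_on ?g S"
  proof (rule inj_onI, rule ccontr)
    fix x y assume xy: "x \<in> S" "y \<in> S" "?g x = ?g y" "x \<noteq> y"
    show False
      using assms(1)[OF xy(1)] assms(1)[OF xy(2)] assms(2)[OF xy(1,2,4)] xy(3) by linarith
  qed
  moreover have "?g ` S \<subseteq> {..<(n + 2) div 3}"
  proof (rule image_subsetI)
    fix x assume "x \<in> S"
    then show "?g x \<in> {..<(n + 2) div 3}"
      using assms(1)[of x] unfolding lessThan_iff by linarith
  qed
  ultimately have "card S \<le> (n + 2) div 3"
    using card_inj_on_le[of ?g S "{..<(n + 2) div 3}"] by simp
  then show ?thesis by linarith
qed

lemma pigeonhole_triple: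
  assumes "finite S" "finite T" "g ` S \<subseteq> T" "2 * card T < card S"
  obtains x y z where "x \<in> S" "y \<in> S" "z \<in> S" "x \<noteq> y" "x \<noteq> z" "y \<noteq> z" "g x = g y" "g x = g z"
proof -
  have "\<exists>c\<in>T. card {x \<in> S. g x = c} > 2"
  proof (rule ccontr)
    assume "\<not> (\<exists>c\<in>T. card {x \<in> S. g x = c} > 2)"
    then have "(\<Sum>c\<in>T. card {x \<in> S. g x = c}) \<le> (\<Sum>c\<in>T. 2)"
      by (intro sum_mono) (meson not_le)
    moreover have "(\<Sum>c\<in>T. card {x \<in> S. g x = c}) = card S"
      using sum.group[OF assms(1-3), of "\<lambda>_. 1::nat"] by simp
    ultimately show False using assms(4) by simp
  qed
  then obtain c where c: "3 \<le> card {x \<in> S. g x = c}" by (metis Suc_leI eval_nat_numeral(3))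
  then obtain Y where Y: "Y \<subseteq> {x \<in> S. g x = c}" "card Y = 3"
    by (metis obtain_subset_with_card_n)
  then obtain x y z where "Y = {x, y, z}" "x \<noteq> y" "x \<noteq> z" "y \<noteq> z"
    by (metis card_3_iff)
  with Y that[of x y z] show ?thesis by auto
qed

text \<open>Neighbourhoods of size at most \<open>card W / 2\<close> that meet cannot cover \<open>W\<close>, and larger ones that
  do not cover \<open>W\<close> must meet; this is why the two halves \<open>S\<close> and \<open>L\<close> below have spaced degrees.\<close>

lemma degree_range:
  assumes "finite W" "cross_free E B W" "symp E" "finite B" "p \<in> W" "q \<in> W"
  shows "3 * card (nbr E B p) \<le> 3 * card (nbr E B q) + card W + 3"
proof -
  define d where "d x = card (nbr E W x)" for x
  define S where "S = {x \<in> nbr E B p. 2 * d x \<le> card W}"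
  define L where "L = {x \<in> B - nbr E B q. card W < 2 * d x}"
  have dW: "d x \<le> card W" for x
    unfolding d_def using assms(1) by (simp add: card_mono nbr_subset)
  have far: "d x + 2 < d y \<or> d y + 2 < d x"
    if "x \<in> B" "y \<in> B" "x \<noteq> y" "nbr E W x \<inter> nbr E W y \<noteq> {}" "nbr E W x \<union> nbr E W y \<noteq> W" for x y
    using assms(2) that unfolding cross_free_def close_deg_def d_def by (meson not_le)
  have UI: "card (nbr E W x \<union> nbr E W y) + card (nbr E W x \<inter> nbr E W y) = d x + d y" for x y
    unfolding d_def using card_Un_Int[of "nbr E W x" "nbr E W y"] assms(1) by simp
  have "3 * card S \<le> card W div 2 + 2"
  proof (rule card_spaced_le[where f = d and l = 1])
    fix x assume x: "x \<in> S"
    then have "p \<in> nbr E W x"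
      using assms(3,5) by (auto simp: S_def nbr_def dest: sympD)
    then have "d x \<noteq> 0" unfolding d_def using assms(1) by auto
    then show "1 \<le> d x \<and> d x < 1 + card W div 2"
      using x by (auto simp: S_def)
  next
    fix x y assume xy: "x \<in> S" "y \<in> S" "x \<noteq> y"
    then have B: "x \<in> B" "y \<in> B" by (auto simp: S_def nbr_def)
    have p: "p \<in> nbr E W x \<inter> nbr E W y"
      using assms(3,5) xy by (auto simp: S_def nbr_def dest: sympD)
    then have "card (nbr E W x \<inter> nbr E W y) \<noteq> 0"
      using assms(1) by auto
    with UI[of x y] xy have "nbr E W x \<union> nbr E W y \<noteq> W"
      by (auto simp: S_def)
    with p far[OF B xy(3)] show "d x + 2 < d y \<or> d y + 2 < d x" by blast
  qed
  moreover have "3 * card L \<le> (card W - 1 - card W div 2) + 2"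
  proof (rule card_spaced_le[where f = d and l = "card W div 2 + 1"])
    fix x assume x: "x \<in> L"
    then have "q \<notin> nbr E W x"
      using assms(3,6) by (auto simp: L_def nbr_def dest: sympD)
    then have "nbr E W x \<subset> W"
      using assms(6) nbr_subset[of E W x] by blast
    then have "d x < card W" unfolding d_def using assms(1) by (simp add: psubset_card_mono)
    then show "card W div 2 + 1 \<le> d x \<and> d x < card W div 2 + 1 + (card W - 1 - card W div 2)"
      using x by (auto simp: L_def)
  next
    fix x y assume xy: "x \<in> L" "y \<in> L" "x \<noteq> y"
    then have B: "x \<in> B" "y \<in> B" by (auto simp: L_def)
    have q: "q \<notin> nbr E W x \<union> nbr E W y"
      using assms(3,6) xy by (auto simp: L_def nbr_def dest: sympD)
    have "card (nbr E W x \<union> nbr E W y) \<le> card W"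
      using assms(1) by (intro card_mono) (auto simp: nbr_def)
    with UI[of x y] xy have "nbr E W x \<inter> nbr E W y \<noteq> {}"
      by (auto simp: L_def)
    with q far[OF B xy(3)] assms(6) show "d x + 2 < d y \<or> d y + 2 < d x" by blast
  qed
  \<comment> \<open>A neighbour of \<open>p\<close> not adjacent to \<open>q\<close> lies in
    \<open>S\<close> or in \<open>L\<close>, according to its degree.\<close>
  moreover have "card (nbr E B p) \<le> card (S \<union> nbr E B q \<union> L)"
    using assms(4) by (intro card_mono) (auto simp: S_def L_def nbr_def)
  moreover have "card (S \<union> nbr E B q \<union> L) \<le> card S + card (nbr E B q) + card L"
    by (meson card_Un_le le_trans add_right_mono)
  \<comment> \<open>This makes the truncated subtraction \<open>card W - 1\<close> exact, so that
    the bounds for \<open>S\<close> and \<open>L\<close> add up to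
    \<open>card W + 3\<close>.\<close>
  moreover have "1 \<le> card W"
    using assms(1,5) by (metis One_nat_def Suc_leI card_gt_0_iff empty_iff)
  ultimately show ?thesis by linarith
qed

text \<open>By \<open>degree_range\<close> the degrees exceed their minimum by at most
  \<open>(card W + 3) / 3\<close>. Cutting this range into blocks of three consecutive values leaves
  at most \<open>(card W + 12) div 9\<close> blocks, fewer than half of \<open>card W\<close>, so
  some block receives three vertices.\<close>

lemma close_triple:
  assumes "finite W" "finite B" "symp E" "cross_free E B W" "4 \<le> card W"
  obtains p q r where "p \<in> W" "q \<in> W" "r \<in> W" "p \<noteq> q" "p \<noteq> r" "q \<noteq> r"
    "close_deg E B p q" "close_deg E B p r" "close_deg E B q r"
proof -
  let ?d = "\<lambda>p. card (nbr E B p)"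
  have "W \<noteq> {}" using assms(5) by auto
  then obtain m where m: "m \<in> W" "\<And>p. p \<in> W \<Longrightarrow> ?d m \<le> ?d p"
    using ex_min_if_finite[of "?d ` W"] assms(1) by (metis (mono_tags) arg_min_if_finite(1) arg_min_least)
  let ?g = "\<lambda>p. (?d p - ?d m) div 3"
  have "?g ` W \<subseteq> {..<(card W + 12) div 9}"
  proof (rule image_subsetI)
    fix p assume "p \<in> W"
    then show "?g p \<in> {..<(card W + 12) div 9}"
      using degree_range[OF assms(1,4,3,2) \<open>p \<in> W\<close> m(1)] unfolding lessThan_iff by linarith
  qed
  moreover have "2 * card {..<(card W + 12) div 9} < card W"
    using assms(5) by simp
  ultimately obtain p q r where
    "p \<in> W" "q \<in> W" "r \<in> W" "p \<noteq> q" "p \<noteq> r" "q \<noteq> r" and g: "?g p = ?g q" "?g p = ?g r"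
    using pigeonhole_triple[of W "{..<(card W + 12) div 9}" ?g] assms(1) by blast
  moreover have "close_deg E B x y" if "x \<in> W" "y \<in> W" "?g x = ?g y" for x y
    using m(2)[OF that(1)] m(2)[OF that(2)] that(3) unfolding close_deg_def by linarith
  ultimately show ?thesis by (intro that[of p q r]) (auto simp: g)
qed

section \<open>Disjoint neighbourhoods\<close>

text \<open>If the neighbourhoods of \<open>x\<close> and \<open>y\<close> covered \<open>W\<close>,
  each of \<open>p\<close>, \<open>q\<close>, \<open>r\<close> would be adjacent to \<open>x\<close>
  or \<open>y\<close>, so two of them would share a neighbour. Hence only the disjoint alternative
  of \<open>cross_free\<close> remains.\<close>

lemma disjoint_if_disjoint_triple:
  assumes "symp E" "cross_free E B W" "p \<in> W" "q \<in> W" "r \<in> W"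
    and "nbr E B p \<inter> nbr E B q = {}" "nbr E B p \<inter> nbr E B r = {}" "nbr E B q \<inter> nbr E B r = {}"
    and "x \<in> B" "y \<in> B" "x \<noteq> y" "close_deg E W x y"
  shows "nbr E W x \<inter> nbr E W y = {}"
proof -
  have m: "c \<in> nbr E W z \<longleftrightarrow> z \<in> nbr E B c" if "c \<in> W" "z \<in> B" for c z
    using mem_nbr_commute[OF assms(1) that(2,1)] .
  have "p \<notin> nbr E W x \<union> nbr E W y \<or> q \<notin> nbr E W x \<union> nbr E W y \<or> r \<notin> nbr E W x \<union> nbr E W y"
    using assms(6-8) unfolding Un_iff m[OF assms(3,9)] m[OF assms(3,10)] m[OF assms(4,9)]
      m[OF assms(4,10)] m[OF assms(5,9)] m[OF assms(5,10)] by blast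
  then have "nbr E W x \<union> nbr E W y \<noteq> W"
    using assms(3-5) by blast
  then show ?thesis
    using assms unfolding cross_free_def by blast
qed

text \<open>Once close vertices have disjoint neighbourhoods, the degrees inside a neighbourhood are
  at least 3 apart, so a vertex of maximum degree \<open>D\<close> has a neighbour of degree at least \<open>3 * D - 2\<close>.\<close>

lemma no_disjoint_triple:
  assumes fin: "finite B" "finite W" and sym: "symp E"
    and cf: "cross_free E B W" "cross_free E W B" and "4 \<le> card B"
    and pqr: "p \<in> W" "q \<in> W" "r \<in> W" "p \<noteq> q" "close_deg E B p q"
    and dis: "nbr E B p \<inter> nbr E B q = {}" "nbr E B p \<inter> nbr E B r = {}" "nbr E B q \<inter> nbr E B r = {}"
  shows False
proof -
  have disB: "nbr E W x \<inter> nbr E W y = {}"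
    if "x \<in> B" "y \<in> B" "x \<noteq> y" "close_deg E W x y" for x y
    using disjoint_if_disjoint_triple[OF sym cf(1) pqr(1-3) dis that] .
  \<comment> \<open>A close triple in \<open>B\<close> has disjoint neighbourhoods by
    \<open>disB\<close>, so the argument can be repeated with the sides exchanged.\<close>
  obtain a b c where "a \<in> B" "b \<in> B" "c \<in> B" "a \<noteq> b" "a \<noteq> c" "b \<noteq> c"
    "close_deg E W a b" "close_deg E W a c" "close_deg E W b c"
    using close_triple[OF fin sym cf(2) \<open>4 \<le> card B\<close>] .
  then have disW: "nbr E B x \<inter> nbr E B y = {}"
    if "x \<in> W" "y \<in> W" "x \<noteq> y" "close_deg E B x y" for x y
    using disjoint_if_disjoint_triple[OF sym cf(2), of a b c x y] that disB by blast
  have bound: "3 * card (nbr E S x) \<le> D + 2"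
    if "x \<in> A" "finite A" and max: "\<And>y. y \<in> S \<Longrightarrow> card (nbr E A y) \<le> D"
      and dis: "\<And>y z. y \<in> S \<Longrightarrow> z \<in> S \<Longrightarrow> y \<noteq> z \<Longrightarrow> close_deg E A y z \<Longrightarrow> nbr E A y \<inter> nbr E A z = {}"
    for A S x D
  proof (rule card_spaced_le[where f = "\<lambda>y. card (nbr E A y)" and l = 1])
    fix y assume y: "y \<in> nbr E S x"
    then have "x \<in> nbr E A y" using sym that(1) by (auto simp: nbr_def dest: sympD)
    then have "card (nbr E A y) \<noteq> 0" using that(2) by auto
    moreover have "card (nbr E A y) \<le> D" using y max by (auto simp: nbr_def)
    ultimately show "1 \<le> card (nbr E A y) \<and> card (nbr E A y) < 1 + D" by linarith
  next
    fix y z assume yz: "y \<in> nbr E S x" "z \<in> nbr E S x" "y \<noteq> z"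
    then have "x \<in> nbr E A y \<inter> nbr E A z" using sym that(1) by (auto simp: nbr_def dest: sympD)
    then have "\<not> close_deg E A y z" using dis[of y z] yz by (auto simp: nbr_def)
    then show "card (nbr E A y) + 2 < card (nbr E A z) \<or> card (nbr E A z) + 2 < card (nbr E A y)"
      by (auto simp: close_deg_def)
  qed
  define M where "M = (\<lambda>x. card (nbr E W x)) ` B \<union> (\<lambda>y. card (nbr E B y)) ` W"
  have M: "finite M" using fin by (simp add: M_def)
  have pM: "card (nbr E B p) \<in> M" using pqr(1) by (auto simp: M_def)
  \<comment> \<open>Here the bound 2 in \<open>cross_free\<close> matters: the final inequality
    \<open>3 * Max M \<le> Max M + 2\<close> is contradictory only for a maximum of at least
    2.\<close>
  have "2 \<le> card (nbr E B p - nbr E B q)"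
    using cf(2) pqr unfolding cross_free_def by blast
  also have "\<dots> \<le> card (nbr E B p)" using fin by (intro card_mono) auto
  also have "\<dots> \<le> Max M" using M pM by simp
  finally have two: "2 \<le> Max M" .
  have maxB: "card (nbr E W x) \<le> Max M" if "x \<in> B" for x
    using M that by (intro Max_ge) (auto simp: M_def)
  have maxW: "card (nbr E B y) \<le> Max M" if "y \<in> W" for y
    using M that by (intro Max_ge) (auto simp: M_def)
  have "Max M \<in> M" using M pM by (intro Max_in) auto
  then have "3 * Max M \<le> Max M + 2"
    using bound[of _ B W "Max M"] bound[of _ W B "Max M"] fin maxB maxW disB disW
    unfolding M_def by fastforce
  with two show False by linarith
qed

section \<open>Complementing the adjacency relation\<close>

lemma nbr_complement: "nbr (\<lambda>x y. \<not> E x y) S x = S - nbr E S x"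
  by (auto simp: nbr_def)

lemma card_nbr_complement:
  "finite S \<Longrightarrow> card (nbr (\<lambda>x y. \<not> E x y) S x) + card (nbr E S x) = card S"
  by (metis add.commute card_Diff_subset card_mono finite_nbr le_add_diff_inverse nbr_complement nbr_subset)

lemma close_deg_complement:
  "finite S \<Longrightarrow> close_deg (\<lambda>x y. \<not> E x y) S x y \<longleftrightarrow> close_deg E S x y"
  using card_nbr_complement[of S E x] card_nbr_complement[of S E y] unfolding close_deg_def by linarith

text \<open>Complementing swaps the two private neighbourhoods and exchanges disjointness with
  covering, so the hypothesis is used for the pair \<open>y\<close>, \<open>x\<close>.\<close>

lemma cross_free_complement:
  assumes "finite W" "cross_free E B W"
  shows "cross_free (\<lambda>x y. \<not> E x y) B W"
  unfolding cross_free_def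
proof (intro ballI impI)
  fix x y assume xy: "x \<in> B" "y \<in> B" "x \<noteq> y" "close_deg (\<lambda>x y. \<not> E x y) W x y"
  then have "close_deg E W y x"
    using assms(1) by (simp add: close_deg_complement close_deg_commute)
  then have "card (nbr E W y - nbr E W x) \<ge> 2"
    "nbr E W y \<inter> nbr E W x = {} \<or> nbr E W y \<union> nbr E W x = W"
    using assms(2) xy(1,2) xy(3)[symmetric] unfolding cross_free_def by simp_all
  moreover have "nbr (\<lambda>x y. \<not> E x y) W x - nbr (\<lambda>x y. \<not> E x y) W y = nbr E W y - nbr E W x"
    using nbr_subset[of E W] by (auto simp: nbr_complement)
  moreover have "nbr (\<lambda>x y. \<not> E x y) W x \<inter> nbr (\<lambda>x y. \<not> E x y) W y = W - (nbr E W y \<union> nbr E W x)"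
    "nbr (\<lambda>x y. \<not> E x y) W x \<union> nbr (\<lambda>x y. \<not> E x y) W y = W - (nbr E W y \<inter> nbr E W x)"
    by (auto simp: nbr_def)
  ultimately show "2 \<le> card (nbr (\<lambda>x y. \<not> E x y) W x - nbr (\<lambda>x y. \<not> E x y) W y) \<and>
      (nbr (\<lambda>x y. \<not> E x y) W x \<inter> nbr (\<lambda>x y. \<not> E x y) W y = {} \<or>
       nbr (\<lambda>x y. \<not> E x y) W x \<union> nbr (\<lambda>x y. \<not> E x y) W y = W)"
    by (metis Diff_cancel Diff_empty)
qed

text \<open>The three pairs from a close triple are either all disjoint or all covering; the second
  case becomes the first for the complement of \<open>E\<close>.\<close>

lemma no_large_cross_free:
  assumes fin: "finite B" "finite W" and sym: "symp E"
    and cf: "cross_free E B W" "cross_free E W B" and card: "4 \<le> card B" "4 \<le> card W"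
  shows False
proof -
  obtain p q r where pqr: "p \<in> W" "q \<in> W" "r \<in> W" "p \<noteq> q" "p \<noteq> r" "q \<noteq> r"
    "close_deg E B p q" "close_deg E B p r" "close_deg E B q r"
    using close_triple[OF fin(2,1) sym cf(1) card(2)] .
  have neq: "nbr E B x - nbr E B y \<noteq> {}"
    and alt: "nbr E B x \<inter> nbr E B y = {} \<or> nbr E B x \<union> nbr E B y = B"
    if "x \<in> {p, q, r}" "y \<in> {p, q, r}" "x \<noteq> y" for x y
  proof -
    have "close_deg E B x y" using that pqr(7-9) pqr(7-9)[THEN close_deg_commute[THEN iffD1]] by auto
    moreover have "x \<in> W" "y \<in> W" using that pqr by auto
    ultimately have "2 \<le> card (nbr E B x - nbr E B y)"
      and *: "nbr E B x \<inter> nbr E B y = {} \<or> nbr E B x \<union> nbr E B y = B"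
      using cf(2) that(3) unfolding cross_free_def by blast+
    from this(1) show "nbr E B x - nbr E B y \<noteq> {}" by (metis card.empty not_numeral_le_zero)
    from * show "nbr E B x \<inter> nbr E B y = {} \<or> nbr E B x \<union> nbr E B y = B" .
  qed
  \<comment> \<open>Disjointness from \<open>y\<close> together with covering by \<open>y\<close>
    and \<open>z\<close> would put the neighbourhood of \<open>x\<close> inside that of
    \<open>z\<close>, contradicting \<open>neq\<close>.\<close>
  have step: "nbr E B y \<union> nbr E B z \<noteq> B"
    if "nbr E B x \<inter> nbr E B y = {}" "x \<in> {p, q, r}" "z \<in> {p, q, r}" "x \<noteq> z" for x y z
    using that neq[of x z] nbr_subset[of E B x] by blast
  show False
  proof (cases "nbr E B p \<inter> nbr E B q = {}")
    case True
    then have "nbr E B p \<inter> nbr E B r = {}" "nbr E B q \<inter> nbr E B r = {}"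
      using step[of p q r] step[of q p r] alt[of p r] alt[of q r] pqr(4-6) by blast+
    with True no_disjoint_triple[OF fin sym cf card(1) pqr(1-4,7)] show False by blast
  next
    case False
    then have "nbr E B p \<union> nbr E B q = B" "nbr E B p \<union> nbr E B r = B" "nbr E B q \<union> nbr E B r = B"
      using step[of r p q] step[of r q p] alt[of p q] alt[of p r] alt[of q r] pqr(4-6) by blast+
    moreover have "symp (\<lambda>x y. \<not> E x y)"
      using sym by (auto simp: symp_def)
    ultimately show False
      using no_disjoint_triple[OF fin, of "\<lambda>x y. \<not> E x y" p q r] cf card pqr fin
      by (auto simp: cross_free_complement close_deg_complement nbr_complement)
  qed
qed

section \<open>Embedding the forbidden graph\<close>

lemma not_induced_free_if_embedding:
  assumes "graph G" "graph (with_proj F)" "inj_on g (pverts F)" "g ` pverts F \<subseteq> verts G"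
    and adj: "\<And>a b. a \<in> pverts F \<Longrightarrow> b \<in> pverts F \<Longrightarrow> (a, b) \<in> parcs F \<longleftrightarrow> g a \<rightarrow>\<^bsub>G\<^esub> g b"
  shows "\<not> induced_free (with_proj F) G"
proof -
  interpret G: graph G by fact
  interpret F: graph "with_proj F" by fact
  define H where "H = G \<restriction> (g ` pverts F)"
  have ind: "induced_subgraph H G"
    unfolding H_def using assms(4) by (rule G.induced_induce)
  have wf: "wf_digraph H"
    unfolding H_def by (rule G.wellformed_induce_subgraph)
  define f where "f = the_inv_into (pverts F) g"
  have fg: "f (g a) = a" if "a \<in> pverts F" for a
    unfolding f_def using assms(3) that by (rule the_inv_into_f_f)
  \<comment> \<open>An isomorphism must also map arcs. Arcs of \<open>G\<close> are abstract while
    those of \<open>F\<close> are pairs, so an arc goes to the pair of preimages of its ends; this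
    is injective since \<open>G\<close> has no parallel arcs.\<close>
  define hom where "hom = \<lparr> iso_verts = f, iso_arcs = (\<lambda>e. (f (tail G e), f (head G e))),
    iso_head = snd, iso_tail = fst \<rparr>"
  have injf: "inj_on f (g ` pverts F)"
    by (auto simp: inj_on_def fg)
  have ends: "tail G e \<in> g ` pverts F" "head G e \<in> g ` pverts F" "e \<in> arcs G" if "e \<in> arcs H" for e
    using that by (auto simp: H_def)
  have "inj_on (iso_arcs hom) (arcs H)"
  proof (rule inj_onI)
    fix e e' assume e: "e \<in> arcs H" "e' \<in> arcs H" "iso_arcs hom e = iso_arcs hom e'"
    then have "tail G e = tail G e'" "head G e = head G e'"
      using ends[of e] ends[of e'] inj_onD[OF injf] by (auto simp: hom_def)
    then show "e = e'"
      using G.no_multi_arcs[of e e'] ends e by (simp add: arc_to_ends_def)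
  qed
  then have "pre_digraph.digraph_isomorphism H hom"
    unfolding pre_digraph.digraph_isomorphism_def using wf injf by (simp add: hom_def H_def)
  moreover have "iso_arcs hom ` arcs H = parcs F"
  proof (intro equalityI subsetI)
    fix p assume "p \<in> iso_arcs hom ` arcs H"
    then obtain e where e: "e \<in> arcs H" "p = (f (tail G e), f (head G e))"
      by (auto simp: hom_def)
    obtain a b where "a \<in> pverts F" "b \<in> pverts F" "tail G e = g a" "head G e = g b"
      using ends[OF e(1)] by blast
    then show "p \<in> parcs F"
      using adj[of a b] e ends[OF e(1)] by (force simp: fg arcs_ends_conv)
  next
    fix p assume p: "p \<in> parcs F"
    then have v: "fst p \<in> pverts F" "snd p \<in> pverts F"
      using F.tail_in_verts[of p] F.head_in_verts[of p] by simp_all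
    with p adj[OF v] have "g (fst p) \<rightarrow>\<^bsub>G\<^esub> g (snd p)" by simp
    then obtain e where e: "e \<in> arcs G" "tail G e = g (fst p)" "head G e = g (snd p)"
      by auto
    then have "e \<in> arcs H" using v by (simp add: H_def)
    moreover have "p = iso_arcs hom e" using e v by (simp add: hom_def fg)
    ultimately show "p \<in> iso_arcs hom ` arcs H" by blast
  qed
  moreover have "iso_verts hom ` verts H = pverts F"
    by (auto simp: hom_def H_def fg image_image)
  ultimately have "digraph_iso H (with_proj F)"
    unfolding digraph_iso_def by (intro exI[of _ hom]) (simp add: app_iso_def with_proj_def hom_def)
  with ind show ?thesis by (auto simp: induced_free_def)
qed

lemma bipartition_commute: "bipartition G B W \<longleftrightarrow> bipartition G W B"
  unfolding bipartition_def by blast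

text \<open>Otherwise \<open>t\<close> vertices from each of \<open>X\<close> and \<open>Y\<close>,
  with \<open>w\<close> as the middle and \<open>z\<close> as the isolated vertex, induce the
  forbidden graph centred at \<open>x\<close> and \<open>y\<close>.\<close>

lemma F_graph_free_private_small:
  assumes "graph G" "bipartition G P Q" "induced_free (with_proj (F_graph t t)) G"
    and PQ: "x \<in> P" "y \<in> P" "x \<noteq> y" "w \<in> Q" "z \<in> Q" "X \<subseteq> Q" "Y \<subseteq> Q"
    and w: "x \<rightarrow>\<^bsub>G\<^esub> w" "y \<rightarrow>\<^bsub>G\<^esub> w" and z: "\<not> x \<rightarrow>\<^bsub>G\<^esub> z" "\<not> y \<rightarrow>\<^bsub>G\<^esub> z"
    and X: "\<And>c. c \<in> X \<Longrightarrow> x \<rightarrow>\<^bsub>G\<^esub> c \<and> \<not> y \<rightarrow>\<^bsub>G\<^esub> c"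
    and Y: "\<And>c. c \<in> Y \<Longrightarrow> y \<rightarrow>\<^bsub>G\<^esub> c \<and> \<not> x \<rightarrow>\<^bsub>G\<^esub> c"
  shows "card X < t \<or> card Y < t"
proof (rule ccontr)
  assume "\<not> (card X < t \<or> card Y < t)"
  then have card: "t \<le> card X" "t \<le> card Y" by auto
  interpret G: graph G by fact
  have Pv: "P \<subseteq> verts G" and Qv: "Q \<subseteq> verts G" and PQd: "P \<inter> Q = {}"
    and ends: "arcs_ends G \<subseteq> P \<times> Q \<union> Q \<times> P"
    using assms(2) unfolding bipartition_def by auto
  have "finite X" "finite Y"
    using PQ(6,7) Qv G.finite_verts by (meson finite_subset subset_trans)+
  then obtain ex ey where ex: "ex ` {1..t} \<subseteq> X" "inj_on ex {1..t}"
    and ey: "ey ` {1..t} \<subseteq> Y" "inj_on ey {1..t}"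
    using card_le_inj[of "{1..t}" X] card_le_inj[of "{1..t}" Y] card by auto
  define g where "g v = (case v of U_centre \<Rightarrow> x | V_centre \<Rightarrow> y | X_leaf i \<Rightarrow> ex i
    | Y_leaf j \<Rightarrow> ey j | W_middle \<Rightarrow> w | Z_isolated \<Rightarrow> z)" for v
  have g [simp]: "g U_centre = x" "g V_centre = y" "g (X_leaf i) = ex i" "g (Y_leaf i) = ey i"
    "g W_middle = w" "g Z_isolated = z" for i
    by (simp_all add: g_def)
  have exX: "ex i \<in> Q" "x \<rightarrow>\<^bsub>G\<^esub> ex i" "\<not> y \<rightarrow>\<^bsub>G\<^esub> ex i" if "i \<in> {1..t}" for i
  proof -
    have "ex i \<in> X" using ex(1) that by blast
    then show "ex i \<in> Q" "x \<rightarrow>\<^bsub>G\<^esub> ex i" "\<not> y \<rightarrow>\<^bsub>G\<^esub> ex i"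
      using X PQ(6) by blast+
  qed
  have eyY: "ey i \<in> Q" "y \<rightarrow>\<^bsub>G\<^esub> ey i" "\<not> x \<rightarrow>\<^bsub>G\<^esub> ey i" if "i \<in> {1..t}" for i
  proof -
    have "ey i \<in> Y" using ey(1) that by blast
    then show "ey i \<in> Q" "y \<rightarrow>\<^bsub>G\<^esub> ey i" "\<not> x \<rightarrow>\<^bsub>G\<^esub> ey i"
      using Y PQ(7) by blast+
  qed
  have exy: "ex i \<noteq> ey j" if "i \<in> {1..t}" "j \<in> {1..t}" for i j
    using exX(2)[OF that(1)] eyY(3)[OF that(2)] by metis
  have noPP: "\<not> a \<rightarrow>\<^bsub>G\<^esub> b" if "a \<in> P" "b \<in> P" for a b
    using ends PQd that by auto
  have noQQ: "\<not> a \<rightarrow>\<^bsub>G\<^esub> b" if "a \<in> Q" "b \<in> Q" for a b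
    using ends PQd that by auto
  have sym: "a \<rightarrow>\<^bsub>G\<^esub> b \<longleftrightarrow> b \<rightarrow>\<^bsub>G\<^esub> a" for a b
    using arcs_ends_symmetric[OF G.sym_arcs] by blast
  define VF where "VF = pverts (F_graph t t)"
  have VF: "v \<in> VF \<longleftrightarrow> (case v of X_leaf i \<Rightarrow> i \<in> {1..t} | Y_leaf i \<Rightarrow> i \<in> {1..t} | _ \<Rightarrow> True)" for v
    by (cases v) (auto simp: VF_def F_graph_def)
  \<comment> \<open>The two colour classes of the forbidden graph: the centres go to
    \<open>P\<close> and all other vertices to \<open>Q\<close>, so only adjacencies with a centre
    need checking.\<close>
  define cls where "cls v = (v = U_centre \<or> v = V_centre)" for v
  have gP: "g v \<in> P" if "v \<in> VF" "cls v" for v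
    using that PQ by (auto simp: cls_def)
  have gQ: "g v \<in> Q" if "v \<in> VF" "\<not> cls v" for v
    using that PQ exX(1) eyY(1) by (cases v) (auto simp: cls_def VF)
  have adjU: "(U_centre, v) \<in> parcs (F_graph t t) \<longleftrightarrow> x \<rightarrow>\<^bsub>G\<^esub> g v"
    "(v, U_centre) \<in> parcs (F_graph t t) \<longleftrightarrow> x \<rightarrow>\<^bsub>G\<^esub> g v"
    "(V_centre, v) \<in> parcs (F_graph t t) \<longleftrightarrow> y \<rightarrow>\<^bsub>G\<^esub> g v"
    "(v, V_centre) \<in> parcs (F_graph t t) \<longleftrightarrow> y \<rightarrow>\<^bsub>G\<^esub> g v"
    if "v \<in> VF" "\<not> cls v" for v
    using that exX(2,3) eyY(2,3) w z by (cases v; auto simp: cls_def VF F_graph_arcs F_edges_def)+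
  have adj: "(a, b) \<in> parcs (F_graph t t) \<longleftrightarrow> g a \<rightarrow>\<^bsub>G\<^esub> g b" if ab: "a \<in> VF" "b \<in> VF" for a b
  proof (cases "cls a = cls b")
    case True
    then have "(a, b) \<notin> parcs (F_graph t t)"
      by (auto simp: cls_def F_graph_arcs F_edges_def)
    moreover have "\<not> g a \<rightarrow>\<^bsub>G\<^esub> g b"
      using True noPP[of "g a" "g b"] noQQ[of "g a" "g b"] gP gQ ab by blast
    ultimately show ?thesis by simp
  next
    case False
    then consider "a = U_centre" "\<not> cls b" | "a = V_centre" "\<not> cls b"
      | "b = U_centre" "\<not> cls a" | "b = V_centre" "\<not> cls a"
      by (auto simp: cls_def)
    then show ?thesis
    proof cases
      case 1
      then show ?thesis using adjU(1)[OF ab(2)] by simp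
    next
      case 2
      then show ?thesis using adjU(3)[OF ab(2)] by simp
    next
      case 3
      then show ?thesis using adjU(2)[OF ab(1)] sym[of x "g a"] by simp
    next
      case 4
      then show ?thesis using adjU(4)[OF ab(1)] sym[of y "g a"] by simp
    qed
  qed
  have "inj_on g VF"
  proof (rule inj_onI)
    fix a b assume ab: "a \<in> VF" "b \<in> VF" "g a = g b"
    have "cls a = cls b" using gP gQ ab PQd by (metis IntI empty_iff)
    \<comment> \<open>Adjacency to \<open>x\<close> and \<open>y\<close> tells the four kinds of
      non-centres apart.\<close>
    moreover have "x \<rightarrow>\<^bsub>G\<^esub> g a \<longleftrightarrow> x \<rightarrow>\<^bsub>G\<^esub> g b" "y \<rightarrow>\<^bsub>G\<^esub> g a \<longleftrightarrow> y \<rightarrow>\<^bsub>G\<^esub> g b"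
      using ab(3) by simp_all
    ultimately show "a = b"
      using ab PQ(3) w z exX(2,3) eyY(2,3) inj_onD[OF ex(2)] inj_onD[OF ey(2)] exy exy[symmetric]
      by (cases a; cases b) (auto simp: cls_def VF)
  qed
  moreover have "g ` VF \<subseteq> verts G"
    using gP gQ Pv Qv by blast
  ultimately have "\<not> induced_free (with_proj (F_graph t t)) G"
    using adj unfolding VF_def
    by (intro not_induced_free_if_embedding[OF assms(1) graph_F_graph])
  with assms(3) show False by simp
qed

section \<open>Bipartite graphs with all symmetric differences large\<close>

lemma F_graph_free_cross_free:
  assumes "graph G" "bipartition G P Q" "induced_free (with_proj (F_graph t t)) G" "2 \<le> t"
    and V: "V \<subseteq> verts G"
    and sd: "\<And>x y. x \<in> V \<Longrightarrow> y \<in> V \<Longrightarrow> x \<noteq> y \<Longrightarrow>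
      2 * t < card {z \<in> V - {x, y}. (x \<rightarrow>\<^bsub>G\<^esub> z) \<noteq> (y \<rightarrow>\<^bsub>G\<^esub> z)}"
  shows "cross_free (\<lambda>x y. x \<rightarrow>\<^bsub>G\<^esub> y) (P \<inter> V) (Q \<inter> V)"
  unfolding cross_free_def
proof (intro ballI impI)
  let ?N = "nbr (\<lambda>x y. x \<rightarrow>\<^bsub>G\<^esub> y) (Q \<inter> V)"
  fix x y assume xy: "x \<in> P \<inter> V" "y \<in> P \<inter> V" "x \<noteq> y" "close_deg (\<lambda>x y. x \<rightarrow>\<^bsub>G\<^esub> y) (Q \<inter> V) x y"
  interpret G: graph G by fact
  have fin: "finite (Q \<inter> V)" using V G.finite_verts by (meson finite_Int finite_subset)
  have "{z \<in> V - {x, y}. (x \<rightarrow>\<^bsub>G\<^esub> z) \<noteq> (y \<rightarrow>\<^bsub>G\<^esub> z)} \<subseteq> (?N x - ?N y) \<union> (?N y - ?N x)"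
    using xy assms(2) unfolding bipartition_def nbr_def by auto
  then have "card {z \<in> V - {x, y}. (x \<rightarrow>\<^bsub>G\<^esub> z) \<noteq> (y \<rightarrow>\<^bsub>G\<^esub> z)} \<le> card ((?N x - ?N y) \<union> (?N y - ?N x))"
    using fin by (intro card_mono) auto
  also have "\<dots> \<le> card (?N x - ?N y) + card (?N y - ?N x)" by (rule card_Un_le)
  finally have sum: "2 * t < card (?N x - ?N y) + card (?N y - ?N x)"
    using sd[of x y] xy by simp
  have split: "card (?N a) = card (?N a - ?N b) + card (?N a \<inter> ?N b)" for a b
    using fin card_Int_Diff[of "?N a" "?N b"] by simp
  \<comment> \<open>The common neighbours cancel, so the private neighbourhoods differ in size by at
    most 2, as the degrees do.\<close>
  have priv: "t \<le> card (?N x - ?N y)" "t \<le> card (?N y - ?N x)"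
    using sum split[of x y] split[of y x] xy(4) unfolding close_deg_def
    by (simp_all add: Int_commute)
  have "?N x \<inter> ?N y = {} \<or> ?N x \<union> ?N y = Q \<inter> V"
  proof (rule ccontr)
    assume "\<not> ?thesis"
    then obtain w z where "w \<in> ?N x \<inter> ?N y" "z \<in> Q \<inter> V" "z \<notin> ?N x \<union> ?N y"
      by (auto simp: nbr_def)
    then have "card (?N x - ?N y) < t \<or> card (?N y - ?N x) < t"
      using xy(1-3)
      by (intro F_graph_free_private_small[OF assms(1-3), of x y w z]) (auto simp: nbr_def)
    with priv show False by linarith
  qed
  with priv assms(4) show "2 \<le> card (?N x - ?N y) \<and> (?N x \<inter> ?N y = {} \<or> ?N x \<union> ?N y = Q \<inter> V)"
    by linarith
qed

lemma opposite_side_large: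
  assumes "bipartition G P Q" "finite V" "x \<in> P \<inter> V" "y \<in> P \<inter> V"
    and "2 * t < card {z \<in> V - {x, y}. (x \<rightarrow>\<^bsub>G\<^esub> z) \<noteq> (y \<rightarrow>\<^bsub>G\<^esub> z)}"
  shows "2 * t < card (Q \<inter> V)"
proof -
  have "{z \<in> V - {x, y}. (x \<rightarrow>\<^bsub>G\<^esub> z) \<noteq> (y \<rightarrow>\<^bsub>G\<^esub> z)} \<subseteq> Q \<inter> V"
    using assms(1,3,4) unfolding bipartition_def by auto
  then have "card {z \<in> V - {x, y}. (x \<rightarrow>\<^bsub>G\<^esub> z) \<noteq> (y \<rightarrow>\<^bsub>G\<^esub> z)} \<le> card (Q \<inter> V)"
    using assms(2) by (intro card_mono) auto
  with assms(5) show ?thesis by linarith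
qed

text \<open>An induced subgraph is represented by its vertex set \<open>V\<close> with the adjacency
  of \<open>G\<close>, so that the freeness of \<open>G\<close> applies directly.\<close>

lemma F_graph_free_small_pair:
  assumes G: "graph G" and bip: "bipartition G B W"
    and free: "induced_free (with_proj (F_graph t t)) G" and t: "2 \<le> t"
    and V: "V \<subseteq> verts G" "2 \<le> card V"
  shows "\<exists>x \<in> V. \<exists>y \<in> V. x \<noteq> y \<and> card {z \<in> V - {x, y}. (x \<rightarrow>\<^bsub>G\<^esub> z) \<noteq> (y \<rightarrow>\<^bsub>G\<^esub> z)} \<le> 2 * t"
proof (rule ccontr)
  assume contra: "\<not> ?thesis"
  then have sd: "2 * t < card {z \<in> V - {x, y}. (x \<rightarrow>\<^bsub>G\<^esub> z) \<noteq> (y \<rightarrow>\<^bsub>G\<^esub> z)}"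
    if "x \<in> V" "y \<in> V" "x \<noteq> y" for x y
    using that by (meson not_le)
  interpret G: graph G by fact
  have fin: "finite V" using V(1) G.finite_verts by (rule finite_subset)
  have bip': "bipartition G W B" using bip by (simp add: bipartition_commute)
  have large: "2 * t < card (Q \<inter> V)" if PQ: "bipartition G P Q" "2 \<le> card (P \<inter> V)" for P Q
  proof -
    obtain x y where "x \<in> P \<inter> V" "y \<in> P \<inter> V" "x \<noteq> y"
      using PQ(2) fin card_le_Suc0_iff_eq[of "P \<inter> V"] by force
    then show ?thesis using opposite_side_large[OF PQ(1) fin] sd by blast
  qed
  obtain x y where xy: "x \<in> V" "y \<in> V" "x \<noteq> y"
    using V(2) fin card_le_Suc0_iff_eq[of V] by force
  have "{z \<in> V - {x, y}. (x \<rightarrow>\<^bsub>G\<^esub> z) \<noteq> (y \<rightarrow>\<^bsub>G\<^esub> z)} \<subseteq> V" by auto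
  then have "2 * t < card V" using sd[OF xy] fin card_mono by (metis (no_types, lifting) le_trans not_le)
  moreover have "V = (B \<inter> V) \<union> (W \<inter> V)" using V(1) bip unfolding bipartition_def by auto
  then have "card V \<le> card (B \<inter> V) + card (W \<inter> V)" by (metis card_Un_le)
  ultimately have "2 \<le> card (B \<inter> V) \<or> 2 \<le> card (W \<inter> V)" using t by linarith
  \<comment> \<open>Two vertices on one side force more than \<open>2 * t\<close> on the other, and
    these in turn force as many on the first.\<close>
  then have "4 \<le> card (B \<inter> V)" "4 \<le> card (W \<inter> V)"
    using large[OF bip] large[OF bip'] t by linarith+
  moreover have "cross_free (\<lambda>x y. x \<rightarrow>\<^bsub>G\<^esub> y) (B \<inter> V) (W \<inter> V)"
    "cross_free (\<lambda>x y. x \<rightarrow>\<^bsub>G\<^esub> y) (W \<inter> V) (B \<inter> V)"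
    using F_graph_free_cross_free[OF G bip free t V(1) sd] F_graph_free_cross_free[OF G bip' free t V(1) sd]
    by blast+
  moreover have "symp (\<lambda>x y. x \<rightarrow>\<^bsub>G\<^esub> y)"
    using arcs_ends_symmetric[OF G.sym_arcs] by (auto simp: symp_def)
  ultimately show False
    using no_large_cross_free[of "B \<inter> V" "W \<inter> V" "\<lambda>x y. x \<rightarrow>\<^bsub>G\<^esub> y"] fin by simp
qed

theorem theorem7:
  fixes t :: nat and G :: "('a, 'b) pre_digraph" and B W :: "'a set"
  assumes "t \<ge> 2"
    and "graph G"
    and "bipartition G B W"
    and "induced_free (with_proj (F_graph t t)) G"
  shows "symmetric_difference G \<le> 2 * t"
proof -
  interpret graph G by fact
  have "sd_bounded_by G (2 * t)"
    unfolding sd_bounded_by_def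
  proof (intro allI impI)
    fix H assume H: "induced_subgraph H G \<and> card (verts H) \<ge> 2"
    then have sub: "verts H \<subseteq> verts G" and compat: "tail H = tail G" "head H = head G"
      and arcs: "arcs H = {e \<in> arcs G. tail G e \<in> verts H \<and> head G e \<in> verts H}"
      by (auto simp: induced_subgraph_def subgraph_def compatible_def)
    have adj: "x \<rightarrow>\<^bsub>H\<^esub> y \<longleftrightarrow> x \<rightarrow>\<^bsub>G\<^esub> y" if "x \<in> verts H" "y \<in> verts H" for x y
      using that by (auto simp: arcs_ends_conv compat arcs)
    have "sd_pair H x y = card {z \<in> verts H - {x, y}. (x \<rightarrow>\<^bsub>G\<^esub> z) \<noteq> (y \<rightarrow>\<^bsub>G\<^esub> z)}"
      if "x \<in> verts H" "y \<in> verts H" for x y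
      unfolding sd_pair_def using that adj by (intro arg_cong[where f = card]) auto
    then show "\<exists>x \<in> verts H. \<exists>y \<in> verts H. x \<noteq> y \<and> sd_pair H x y \<le> 2 * t"
      using F_graph_free_small_pair[OF assms(2-4,1) sub] H by fastforce
  qed
  then show ?thesis
    unfolding symmetric_difference_def by (rule Least_le)
qed

end
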